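(* Let $G$ be a torsion-free Abelian group and let $\Pi=(\mathcal{P},\mathcal{L})$ be a finite projective plane. Then $\Pi$ is not pseudomagic over $G$; that is, every function $v:\mathcal{P}\to G$ such that $\sum_{x\in L}v(x)$ is the same for all $L\in\mathcal{L}$ is constant.
   Context: A projective plane $\Pi=(\mathcal{P},\mathcal{L})$ consists of a set of points $\mathcal{P}$ and a set $\mathcal{L}$ of lines (each a subset of $\mathcal{P}$) such that any two distinct points lie on a unique common line, any two distinct lines meet in a unique point, and there exist four points no three of which lie on a common line; it is finite if $\mathcal{P}$ is finite. For an Abelian group $G$ and $v:\mathcal{P}\to G$, write $v(S)=\sum_{x\in S}v(x)$ for $S\subseteq\mathcal{P}$. $v$ is line invariant if $v(L)=v(L')$ for all $L,L'\in\mathcal{L}$; $v$ is pseudomagic if it is line invariant and non-constant. $\Pi$ is pseudomagic over $G$ if a pseudomagic $v:\mathcal{P}\to G$ exists. A group is torsion-free if it has no non-identity elements of finite order. *)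

theory Defs
  imports "HOL-Algebra.FiniteProduct"
begin

locale projective_plane =
  fixes points :: "'p set" and lines :: "'p set set"
  assumes lines_subset: "\<And>l. l \<in> lines \<Longrightarrow> l \<subseteq> points"
    and join: "\<And>x y. \<lbrakk>x \<in> points; y \<in> points; x \<noteq> y\<rbrakk> \<Longrightarrow> \<exists>!l. l \<in> lines \<and> x \<in> l \<and> y \<in> l"
    and meet: "\<And>l m. \<lbrakk>l \<in> lines; m \<in> lines; l \<noteq> m\<rbrakk> \<Longrightarrow> \<exists>!x. x \<in> l \<inter> m"
    and quadrangle: "\<exists>Q. Q \<subseteq> points \<and> card Q = 4 \<and>
      (\<forall>T. T \<subseteq> Q \<and> card T = 3 \<longrightarrow> \<not> (\<exists>l\<in>lines. T \<subseteq> l))"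

locale finite_projective_plane = projective_plane +
  assumes finite_points: "finite points"

text \<open>
  Abelian groups are the multiplicatively written \<open>comm_group\<close>s, so the sum of \<open>v\<close> over
  a set of points is a \<open>finprod\<close>. In a finite plane all lines are finite, so its default
  value on infinite sets plays no role.
\<close>

definition torsion_free :: "('g, 'm) monoid_scheme \<Rightarrow> bool" where
  "torsion_free G \<longleftrightarrow>
    (\<forall>x\<in>carrier G. (\<exists>n::nat. n > 0 \<and> x [^]\<^bsub>G\<^esub> n = \<one>\<^bsub>G\<^esub>) \<longrightarrow> x = \<one>\<^bsub>G\<^esub>)"

definition line_invariant :: "('g, 'm) monoid_scheme \<Rightarrow> 'p set set \<Rightarrow> ('p \<Rightarrow> 'g) \<Rightarrow> bool" where
  "line_invariant G lines v \<longleftrightarrow>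
    (\<forall>l\<in>lines. \<forall>l'\<in>lines. finprod G v l = finprod G v l')"

definition pseudomagic ::
    "('g, 'm) monoid_scheme \<Rightarrow> 'p set \<Rightarrow> 'p set set \<Rightarrow> ('p \<Rightarrow> 'g) \<Rightarrow> bool" where
  "pseudomagic G points lines v \<longleftrightarrow> line_invariant G lines v \<and> \<not> (\<exists>c. \<forall>x\<in>points. v x = c)"

definition pseudomagic_over ::
    "'p set \<Rightarrow> 'p set set \<Rightarrow> ('g, 'm) monoid_scheme \<Rightarrow> bool" where
  "pseudomagic_over points lines G \<longleftrightarrow>
    (\<exists>v \<in> points \<rightarrow> carrier G. pseudomagic G points lines v)"

end

theory Submission
  imports Defs
begin

text \<open>
  All points lie on the same number \<open>d \<ge> 2\<close> of lines. Multiplying the line products over the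
  lines through \<open>p\<close> counts \<open>p\<close> \<open>d\<close> times and every other point once, so
  \<open>v p ^ (d - 1)\<close> times the product over all points does not depend on \<open>p\<close>. Hence any quotient
  \<open>v p / v q\<close> is annihilated by \<open>d - 1 > 0\<close>.
\<close>

definition pencil :: "'p set set \<Rightarrow> 'p \<Rightarrow> 'p set set" where
  "pencil lines p = {l \<in> lines. p \<in> l}"

section \<open>Incidence geometry: quadrangles, pencils and the number of lines through a
  point\<close>

context projective_plane
begin

lemma lines_eqI:
  assumes "l \<in> lines" "m \<in> lines" "x \<noteq> y" "x \<in> l" "y \<in> l" "x \<in> m" "y \<in> m"
  shows "l = m"
  using assms join[of x y] lines_subset by blast

text \<open>At most two of the four vertices of a quadrangle lie in \<open>{p, q}\<close>, so some
  vertex outside that set can be named \<open>a\<close>. Non-collinearity of triples becomes a bound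
  on intersections with lines.\<close>

lemma ex_four_points_general_position:
  obtains a b c d where "{a, b, c, d} \<subseteq> points" "distinct [a, b, c, d]"
    "\<forall>l\<in>lines. card (l \<inter> {a, b, c, d}) \<le> 2" "a \<notin> {p, q}"
proof -
  obtain Q where Q: "Q \<subseteq> points" "card Q = 4"
    and nc: "\<forall>T. T \<subseteq> Q \<and> card T = 3 \<longrightarrow> \<not> (\<exists>l\<in>lines. T \<subseteq> l)"
    using quadrangle by (elim exE conjE)
  have "\<not> Q \<subseteq> {p, q}"
  proof
    assume "Q \<subseteq> {p, q}"
    then have "card Q \<le> card {p, q}" by (simp add: card_mono)
    also have "\<dots> \<le> 2" by (simp add: card_insert_if)
    finally show False using Q(2) by simp
  qed
  then obtain a where a: "a \<in> Q" "a \<notin> {p, q}" by blast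
  then have "card (Q - {a}) = 3" using Q(2) by simp
  then obtain b c d where bcd: "Q - {a} = {b, c, d}" "distinct [b, c, d]"
    unfolding card_3_iff by auto
  have "Q = insert a (Q - {a})" using a(1) by blast
  then have Qeq: "Q = {a, b, c, d}" by (simp only: bcd(1))
  have "a \<notin> {b, c, d}" unfolding bcd(1)[symmetric] by simp
  then have dist: "distinct [a, b, c, d]" using bcd(2) by simp
  have "\<forall>l\<in>lines. card (l \<inter> Q) \<le> 2"
  proof (rule ballI, rule ccontr)
    fix l assume l: "l \<in> lines" "\<not> card (l \<inter> Q) \<le> 2"
    then have "3 \<le> card (l \<inter> Q)" by simp
    then obtain T where T: "T \<subseteq> l \<inter> Q" "card T = 3"
      by (rule obtain_subset_with_card_n)
    then have "\<not> (\<exists>l\<in>lines. T \<subseteq> l)" using nc by simp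
    then show False using T(1) l(1) by blast
  qed
  then show thesis
    using that[of a b c d] dist Q(1) a(2) unfolding Qeq by blast
qed

text \<open>The three lines are the sides of a quadrangle that join \<open>a\<close> to the other
  vertices; if two of them coincided, that line would contain three vertices.\<close>

lemma ex_three_lines_through_common_point:
  obtains a l m n where "a \<in> points" "a \<notin> {p, q}" "distinct [l, m, n]"
    "{l, m, n} \<subseteq> pencil lines a"
proof -
  obtain a b c d where pts: "{a, b, c, d} \<subseteq> points" and dist: "distinct [a, b, c, d]"
    and le2: "\<forall>l\<in>lines. card (l \<inter> {a, b, c, d}) \<le> 2" and a: "a \<notin> {p, q}"
    by (rule ex_four_points_general_position[where p = p and q = q])
  have nc: False if "l \<in> lines" "{a, y, z} \<subseteq> l" "{y, z} \<subseteq> {b, c, d}" "y \<noteq> z" for l y z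
  proof -
    have "a \<noteq> y" "a \<noteq> z" using that(3) dist by auto
    then have "3 = card {a, y, z}" using that(4) by simp
    also have "\<dots> \<le> card (l \<inter> {a, b, c, d})"
      using that(2,3) by (intro card_mono) auto
    also have "\<dots> \<le> 2" using le2 that(1) by blast
    finally show False by simp
  qed
  obtain l where l: "l \<in> lines" "a \<in> l" "b \<in> l"
    using join[of a b] pts dist by auto
  obtain m where m: "m \<in> lines" "a \<in> m" "c \<in> m"
    using join[of a c] pts dist by auto
  obtain n where n: "n \<in> lines" "a \<in> n" "d \<in> n"
    using join[of a d] pts dist by auto
  have "l \<noteq> m" "l \<noteq> n" "m \<noteq> n"
    using nc[of l b c] nc[of l b d] nc[of m c d] l m n dist by auto
  then show thesis
    using that[of a l m n] pts a l m n by (simp add: pencil_def)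
qed

text \<open>Take three lines through a point \<open>a\<close> other than \<open>p\<close> and
  \<open>q\<close>. Each of \<open>p\<close> and \<open>q\<close> lies on at most one of them, so at
  least one line misses both.\<close>

lemma ex_line_avoiding_two_points:
  obtains l where "l \<in> lines" "p \<notin> l" "q \<notin> l"
proof -
  obtain a l m n where "a \<notin> {p, q}" and dist: "distinct [l, m, n]"
    and pen: "{l, m, n} \<subseteq> pencil lines a"
    by (rule ex_three_lines_through_common_point[where p = p and q = q])
  then have once: "s = t"
    if "s \<in> {l, m, n}" "t \<in> {l, m, n}" "x \<in> {p, q}" "x \<in> s" "x \<in> t" for s t x
    using that lines_eqI[of s t a x] by (auto simp: pencil_def)
  have "\<exists>s\<in>{l, m, n}. p \<notin> s \<and> q \<notin> s"
    using once[of l m] once[of l n] once[of m n] dist by auto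
  then show thesis
    using that pen by (auto simp: pencil_def)
qed

text \<open>Projection from \<open>p\<close> onto \<open>l\<close>, sending a line through
  \<open>p\<close> to its intersection with \<open>l\<close>, is a bijection because
  \<open>p\<close> is not on \<open>l\<close>.\<close>

lemma card_pencil_eq_card_line:
  assumes p: "p \<in> points" and l: "l \<in> lines" "p \<notin> l"
  shows "card (pencil lines p) = card l"
proof -
  define f where "f m = (THE x. x \<in> m \<inter> l)" for m
  have f: "f m \<in> m \<inter> l" if "m \<in> pencil lines p" for m
    unfolding f_def by (rule theI', rule meet) (use that l in \<open>auto simp: pencil_def\<close>)
  have "bij_betw f (pencil lines p) l"
  proof (rule bij_betw_imageI)
    show "inj_on f (pencil lines p)"
    proof (rule inj_onI)
      fix m n assume mn: "m \<in> pencil lines p" "n \<in> pencil lines p" "f m = f n"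
      then show "m = n"
        using f[of m] f[of n] l lines_eqI[of m n p "f m"] by (auto simp: pencil_def)
    qed
    show "f ` pencil lines p = l"
    proof
      show "f ` pencil lines p \<subseteq> l" using f by blast
      show "l \<subseteq> f ` pencil lines p"
      proof
        fix x assume x: "x \<in> l"
        then have "x \<in> points" "p \<noteq> x" using l lines_subset by auto
        then obtain m where m: "m \<in> lines" "p \<in> m" "x \<in> m"
          using join[of p x] p by auto
        then have mp: "m \<in> pencil lines p" by (simp add: pencil_def)
        \<comment> \<open>Both \<open>x\<close> and \<open>f m\<close> lie on the distinct lines
          \<open>m\<close> and \<open>l\<close>, so they are the same point.\<close>
        have "m \<noteq> l" using m l by blast
        then have "f m = x"
          using f[OF mp] m x l lines_eqI[of m l "f m" x] by blast
        then show "x \<in> f ` pencil lines p" using mp by blast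
      qed
    qed
  qed
  then show ?thesis by (rule bij_betw_same_card)
qed

text \<open>Both pencils are compared with one line that avoids both points.\<close>

lemma card_pencil_eq:
  assumes "p \<in> points" "q \<in> points"
  shows "card (pencil lines p) = card (pencil lines q)"
proof -
  obtain l where "l \<in> lines" "p \<notin> l" "q \<notin> l"
    by (rule ex_line_avoiding_two_points)
  then show ?thesis
    using assms by (simp add: card_pencil_eq_card_line)
qed

lemma Union_pencil_minus:
  assumes "p \<in> points"
  shows "(\<Union>l\<in>pencil lines p. l - {p}) = points - {p}"
proof
  show "(\<Union>l\<in>pencil lines p. l - {p}) \<subseteq> points - {p}"
    using lines_subset by (auto simp: pencil_def)
  show "points - {p} \<subseteq> (\<Union>l\<in>pencil lines p. l - {p})"
  proof
    fix x assume x: "x \<in> points - {p}"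
    then obtain l where "l \<in> lines" "p \<in> l" "x \<in> l"
      using join[of p x] assms by auto
    then show "x \<in> (\<Union>l\<in>pencil lines p. l - {p})"
      using x by (auto simp: pencil_def)
  qed
qed

end

section \<open>Finite planes: multiplying the line products over a pencil\<close>

context finite_projective_plane
begin

lemma finite_line: "l \<in> lines \<Longrightarrow> finite l"
  using lines_subset finite_points finite_subset by metis

lemma finite_pencil: "finite (pencil lines p)"
proof (rule finite_subset)
  show "pencil lines p \<subseteq> Pow points" using lines_subset by (auto simp: pencil_def)
qed (simp add: finite_points)

text \<open>This makes the exponent \<open>d - 1\<close> positive, as torsion-freeness requires.
  Some point lies on three lines, and all pencils have the same size.\<close>

lemma card_pencil_ge_2:
  assumes "p \<in> points"
  shows "2 \<le> card (pencil lines p)"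
proof -
  obtain a l m n where a: "a \<in> points" and "distinct [l, m, n]"
    and sub: "{l, m, n} \<subseteq> pencil lines a"
    by (rule ex_three_lines_through_common_point)
  then have "card {l, m, n} = 3" by simp
  then have "3 \<le> card (pencil lines a)"
    using card_mono[OF finite_pencil sub] by simp
  then show ?thesis using card_pencil_eq[OF assms a] by simp
qed

text \<open>The right-hand side depends on \<open>p\<close> only through the size of its pencil, so
  it is the same for all points.\<close>

lemma finprod_pencil:
  fixes G (structure)
  assumes "comm_group G" and v: "v \<in> points \<rightarrow> carrier G" and p: "p \<in> points"
    and const: "\<And>l. l \<in> lines \<Longrightarrow> finprod G v l = c"
    and c: "c \<in> carrier G"
  shows "v p [^] (card (pencil lines p) - 1) \<otimes> finprod G v points = c [^] card (pencil lines p)"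
proof -
  interpret comm_group G by fact
  let ?L = "pencil lines p"
  have vp: "v p \<in> carrier G" using v p by blast
  have closed: "v \<in> l \<rightarrow> carrier G" if "l \<in> ?L" for l
    using that v lines_subset by (auto simp: pencil_def)
  \<comment> \<open>Separating \<open>p\<close> from each line leaves pieces that are pairwise
    disjoint.\<close>
  have split: "c = v p \<otimes> finprod G v (l - {p})" if "l \<in> ?L" for l
  proof -
    have "finprod G v (insert p (l - {p})) = v p \<otimes> finprod G v (l - {p})"
      using that vp closed[OF that] finite_line
      by (intro finprod_insert) (auto simp: pencil_def)
    moreover have "insert p (l - {p}) = l" using that by (auto simp: pencil_def)
    ultimately show ?thesis using const that by (simp add: pencil_def)
  qed
  have split_points: "finprod G v points = v p \<otimes> finprod G v (points - {p})"
  proof -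
    have "finprod G v (insert p (points - {p})) = v p \<otimes> finprod G v (points - {p})"
      using vp v finite_points by (intro finprod_insert) auto
    then show ?thesis using p by (simp add: insert_absorb)
  qed
  have rest: "finprod G v (points - {p}) \<in> carrier G"
    using v by (intro finprod_closed) auto
  have "c [^] card ?L = (\<Otimes>l\<in>?L. c)"
    using c by (simp add: finprod_const)
  also have "\<dots> = (\<Otimes>l\<in>?L. v p \<otimes> finprod G v (l - {p}))"
    using split vp closed by (intro finprod_cong') (auto intro!: m_closed finprod_closed)
  also have "\<dots> = (\<Otimes>l\<in>?L. v p) \<otimes> (\<Otimes>l\<in>?L. finprod G v (l - {p}))"
    using vp closed by (intro finprod_multf) (auto intro!: finprod_closed)
  also have "(\<Otimes>l\<in>?L. v p) = v p [^] card ?L"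
    using vp by (simp add: finprod_const)
  also have "(\<Otimes>l\<in>?L. finprod G v (l - {p})) = finprod G v (\<Union>l\<in>?L. l - {p})"
  proof (rule finprod_UN_disjoint[symmetric])
    \<comment> \<open>Two lines through \<open>p\<close> with a further common point
      coincide.\<close>
    show "pairwise (\<lambda>l m. disjnt (l - {p}) (m - {p})) ?L"
      unfolding pairwise_def disjnt_def pencil_def using lines_eqI by blast
  qed (use finite_pencil finite_line closed in \<open>auto simp: pencil_def\<close>)
  also have "(\<Union>l\<in>?L. l - {p}) = points - {p}"
    using p by (rule Union_pencil_minus)
  \<comment> \<open>The pencil is nonempty, so the subtraction is not truncated. The factor
    \<open>v p\<close> split off here completes the product over \<open>points - {p}\<close> to one
    over \<open>points\<close>.\<close>
  also have "v p [^] card ?L = v p [^] (card ?L - 1) \<otimes> v p"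
    using card_pencil_ge_2[OF p] nat_pow_Suc[of "v p" "card ?L - 1"] by simp
  finally show ?thesis
    using split_points vp rest by (simp add: m_assoc)
qed

end

text \<open>By commutativity the \<open>n\<close>-th power of \<open>x \<otimes> inv y\<close> is
  the quotient of the \<open>n\<close>-th powers, so this element has finite order.\<close>

lemma (in comm_group) torsion_free_nat_pow_inj:
  assumes "torsion_free G" "x \<in> carrier G" "y \<in> carrier G"
    and "x [^] n = y [^] n" "n > (0::nat)"
  shows "x = y"
proof -
  have "(x \<otimes> inv y) [^] n = \<one>"
    using assms by (simp add: nat_pow_distrib nat_pow_inv)
  then have "x \<otimes> inv y = \<one>"
    using assms unfolding torsion_free_def by blast
  then show ?thesis
    using assms by (metis inv_equality inv_inv inv_closed)
qed

lemma (in finite_projective_plane) line_invariant_imp_constant: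
  fixes G (structure)
  assumes G: "comm_group G" "torsion_free G" and v: "v \<in> points \<rightarrow> carrier G"
    and inv: "line_invariant G lines v" and p: "p \<in> points" and q: "q \<in> points"
  shows "v p = v q"
proof -
  interpret comm_group G by fact
  \<comment> \<open>This supplies a reference line, whose product serves as the common value
    \<open>?c\<close>.\<close>
  obtain l where l: "l \<in> lines"
    by (rule ex_line_avoiding_two_points)
  let ?d = "card (pencil lines p)" and ?c = "finprod G v l"
  have c: "?c \<in> carrier G"
    using v lines_subset[OF l] by (intro finprod_closed) auto
  have const: "finprod G v m = ?c" if "m \<in> lines" for m
    using inv l that unfolding line_invariant_def by blast
  have pts: "finprod G v points \<in> carrier G" "v p \<in> carrier G" "v q \<in> carrier G"
    using v p q by (auto intro: finprod_closed)
  \<comment> \<open>Both sides equal \<open>?c [^] ?d\<close>; the product over all points then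
    cancels.\<close>
  have "v p [^] (?d - 1) \<otimes> finprod G v points = v q [^] (?d - 1) \<otimes> finprod G v points"
    using finprod_pencil[OF G(1) v p const c] finprod_pencil[OF G(1) v q const c]
      card_pencil_eq[OF p q] by simp
  then have "v p [^] (?d - 1) = v q [^] (?d - 1)"
    using pts by simp
  then show ?thesis
    using torsion_free_nat_pow_inj[OF G(2)] pts card_pencil_ge_2[OF p] by simp
qed

theorem theorem2:
  fixes G :: "('g, 'm) monoid_scheme"
    and points :: "'p set" and lines :: "'p set set"
  assumes "comm_group G"
    and "torsion_free G"
    and "finite_projective_plane points lines"
  shows "\<not> pseudomagic_over points lines G
    \<and> (\<forall>v \<in> points \<rightarrow> carrier G. line_invariant G lines v \<longrightarrow> (\<exists>c. \<forall>x\<in>points. v x = c))"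
proof -
  have "\<exists>c. \<forall>x\<in>points. v x = c"
    if "v \<in> points \<rightarrow> carrier G" "line_invariant G lines v" for v
    using finite_projective_plane.line_invariant_imp_constant[OF assms(3,1,2) that] by blast
  then show ?thesis
    unfolding pseudomagic_over_def pseudomagic_def by blast
qed

end
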